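(* Let $G$ be a finite group, $H\le G$ a subgroup, and $e\in E^\bullet(H)$ an idempotent. The weak lumping algebra $\Theta(e)$ of $e$ is a parabolic subalgebra of $\mathbb{C}[G]$. It satisfies \[\Theta(e)=\bigl(\mathbb{C}[G](e-\eta_H)+(1-e)\mathbb{C}[G]\bigr)\oplus\eta_H\mathbb{C}[G]\eta_H .\]
   Context: $\eta_H=|H|^{-1}\sum_{h\in H}h$, and $E^\bullet(H)$ is the set of idempotents $e\in\mathbb{C}[H]$ with $\eta_He=\eta_H$. For $e\in E^\bullet(H)$, the weak lumping algebra of $e$ is $\Theta(e)=\{w\in\mathbb{C}[G]:ew(1-e)=0,\ (e-\eta_H)w\eta_H=0\}$. Fix a Wedderburn isomorphism $\mathbb{C}[G]\cong\bigoplus_{V\in\mathrm{Irr}(G)}\mathrm{Mat}_{\dim V}(\mathbb{C})$. The standard Borel subalgebra of $\mathbb{C}[G]$ is the product of the subalgebras of lower triangular matrices in each factor. A subalgebra of $\mathbb{C}[G]$ is parabolic if it is conjugate by an element of $\mathbb{C}[G]^\times$ to a subalgebra containing the standard Borel subalgebra. The symbol $\oplus$ means a direct sum of vector subspaces of $\mathbb{C}[G]$. *)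

theory Defs
  imports "HOL-Algebra.QuotRing" "HOL-Algebra.Subrings" "Jordan_Normal_Form.VS_Connect"
begin

(* Elements of C[G] are coefficient functions that vanish outside the carrier, so that for a
   subgroup H the group algebra of H is literally a subset of the group algebra of G. *)
definition group_algebra :: "('a, 'b) monoid_scheme \<Rightarrow> (complex, 'a \<Rightarrow> complex) module" where
  "group_algebra G = \<lparr>
     carrier = {w. \<forall>x. x \<notin> carrier G \<longrightarrow> w x = 0},
     mult = (\<lambda>v w x. if x \<in> carrier G
                      then \<Sum>y\<in>carrier G. v y * w (inv\<^bsub>G\<^esub> y \<otimes>\<^bsub>G\<^esub> x) else 0),
     one = (\<lambda>x. if x = \<one>\<^bsub>G\<^esub> then 1 else 0),
     zero = (\<lambda>x. 0),
     add = (\<lambda>v w x. v x + w x),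
     smult = (\<lambda>c w x. c * w x)\<rparr>"

definition eta :: "'a set \<Rightarrow> 'a \<Rightarrow> complex" where
  "eta H = (\<lambda>x. if x \<in> H then 1 / of_nat (card H) else 0)"

definition E_bullet :: "('a, 'b) monoid_scheme \<Rightarrow> 'a set \<Rightarrow> ('a \<Rightarrow> complex) set" where
  "E_bullet G H = {e \<in> carrier (group_algebra (G\<lparr>carrier := H\<rparr>)).
     e \<otimes>\<^bsub>group_algebra G\<^esub> e = e \<and> eta H \<otimes>\<^bsub>group_algebra G\<^esub> e = eta H}"

definition weak_lumping_algebra ::
    "('a, 'b) monoid_scheme \<Rightarrow> 'a set \<Rightarrow> ('a \<Rightarrow> complex) \<Rightarrow> ('a \<Rightarrow> complex) set" where
  "weak_lumping_algebra G H e = (let A = group_algebra G in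
     {w \<in> carrier A.
        e \<otimes>\<^bsub>A\<^esub> w \<otimes>\<^bsub>A\<^esub> (\<one>\<^bsub>A\<^esub> \<ominus>\<^bsub>A\<^esub> e) = \<zero>\<^bsub>A\<^esub> \<and>
        (e \<ominus>\<^bsub>A\<^esub> eta H) \<otimes>\<^bsub>A\<^esub> w \<otimes>\<^bsub>A\<^esub> eta H = \<zero>\<^bsub>A\<^esub>})"

(* A finite-dimensional complex representation is given, up to isomorphism, by its degree n
   together with a homomorphism into GL_n(C). *)
type_synonym 'a matrix_rep = "nat \<times> ('a \<Rightarrow> complex mat)"

definition is_matrix_rep :: "('a, 'b) monoid_scheme \<Rightarrow> 'a matrix_rep \<Rightarrow> bool" where
  "is_matrix_rep G = (\<lambda>(n, \<rho>). \<rho> \<in> hom G (units_of (ring_mat TYPE(complex) n ())))"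

definition irreducible_rep :: "('a, 'b) monoid_scheme \<Rightarrow> 'a matrix_rep \<Rightarrow> bool" where
  "irreducible_rep G = (\<lambda>(n, \<rho>). is_matrix_rep G (n, \<rho>) \<and> n \<noteq> 0 \<and>
     (\<forall>W. subspace class_ring W (module_vec TYPE(complex) n) \<longrightarrow>
          (\<forall>g\<in>carrier G. \<forall>v\<in>W. \<rho> g *\<^sub>v v \<in> W) \<longrightarrow>
          W = {0\<^sub>v n} \<or> W = carrier_vec n))"

definition rep_isomorphic :: "('a, 'b) monoid_scheme \<Rightarrow> 'a matrix_rep \<Rightarrow> 'a matrix_rep \<Rightarrow> bool" where
  "rep_isomorphic G = (\<lambda>(n, \<rho>) (m, \<sigma>). n = m \<and>
     (\<exists>P \<in> Units (ring_mat TYPE(complex) n ()). \<forall>g\<in>carrier G. P * \<rho> g = \<sigma> g * P))"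

definition Irr :: "('a, 'b) monoid_scheme \<Rightarrow> 'a matrix_rep set set" where
  "Irr G = {r. irreducible_rep G r} //
     {(r, s). irreducible_rep G r \<and> irreducible_rep G s \<and> rep_isomorphic G r s}"

definition irr_dim :: "'a matrix_rep set \<Rightarrow> nat" where
  "irr_dim V = (THE n. \<exists>\<rho>. (n, \<rho>) \<in> V)"

(* The product of the matrix algebras of sizes d i, i in I; for finite I it is their direct sum. *)
definition matrix_blocks :: "'i set \<Rightarrow> ('i \<Rightarrow> nat) \<Rightarrow> (complex, 'i \<Rightarrow> complex mat) module" where
  "matrix_blocks I d = \<lparr>
     carrier = (\<Pi>\<^sub>E i\<in>I. carrier_mat (d i) (d i)),
     mult = (\<lambda>M N. \<lambda>i\<in>I. M i * N i),
     one = (\<lambda>i\<in>I. 1\<^sub>m (d i)),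
     zero = (\<lambda>i\<in>I. 0\<^sub>m (d i) (d i)),
     add = (\<lambda>M N. \<lambda>i\<in>I. M i + N i),
     smult = (\<lambda>c M. \<lambda>i\<in>I. c \<cdot>\<^sub>m M i)\<rparr>"

definition wedderburn_iso ::
    "('a, 'b) monoid_scheme \<Rightarrow> (('a \<Rightarrow> complex) \<Rightarrow> 'a matrix_rep set \<Rightarrow> complex mat) \<Rightarrow> bool" where
  "wedderburn_iso G \<phi> \<longleftrightarrow>
     \<phi> \<in> ring_iso (group_algebra G) (matrix_blocks (Irr G) irr_dim) \<and>
     (\<forall>c. \<forall>w\<in>carrier (group_algebra G).
        \<phi> (c \<odot>\<^bsub>group_algebra G\<^esub> w) = c \<odot>\<^bsub>matrix_blocks (Irr G) irr_dim\<^esub> \<phi> w)"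

definition lower_triangular :: "complex mat \<Rightarrow> bool" where
  "lower_triangular M \<longleftrightarrow> (\<forall>i<dim_row M. \<forall>j<dim_col M. i < j \<longrightarrow> M $$ (i, j) = 0)"

definition standard_borel ::
    "('a, 'b) monoid_scheme \<Rightarrow> (('a \<Rightarrow> complex) \<Rightarrow> 'a matrix_rep set \<Rightarrow> complex mat) \<Rightarrow> ('a \<Rightarrow> complex) set" where
  "standard_borel G \<phi> =
     {w \<in> carrier (group_algebra G). \<forall>V\<in>Irr G. lower_triangular (\<phi> w V)}"

(* Subalgebras are unital (subring includes the unit). The library constant
   Embedded_Algebras.subalgebra is a different notion: it does not require closure under products. *)
definition is_subalgebra :: "('a \<Rightarrow> complex) set \<Rightarrow> (complex, 'a \<Rightarrow> complex) module \<Rightarrow> bool" where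
  "is_subalgebra P A \<longleftrightarrow> subring P A \<and> subspace class_ring P A"

definition parabolic ::
    "('a, 'b) monoid_scheme \<Rightarrow> (('a \<Rightarrow> complex) \<Rightarrow> 'a matrix_rep set \<Rightarrow> complex mat) \<Rightarrow> ('a \<Rightarrow> complex) set \<Rightarrow> bool" where
  "parabolic G \<phi> P \<longleftrightarrow> (let A = group_algebra G in
     is_subalgebra P A \<and>
     (\<exists>Q. is_subalgebra Q A \<and> standard_borel G \<phi> \<subseteq> Q \<and>
        (\<exists>u \<in> Units A. P = (\<lambda>q. u \<otimes>\<^bsub>A\<^esub> q \<otimes>\<^bsub>A\<^esub> inv\<^bsub>A\<^esub> u) ` Q)))"

definition internal_direct_sum ::
    "(complex, 'a \<Rightarrow> complex) module \<Rightarrow> ('a \<Rightarrow> complex) set \<Rightarrow> ('a \<Rightarrow> complex) set \<Rightarrow> ('a \<Rightarrow> complex) set \<Rightarrow> bool" where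
  "internal_direct_sum A S U W \<longleftrightarrow>
     subspace class_ring U A \<and> subspace class_ring W A \<and>
     S = U <+>\<^bsub>A\<^esub> W \<and> U \<inter> W = {\<zero>\<^bsub>A\<^esub>}"

end

theory Submission
  imports Defs "Jordan_Normal_Form.Schur_Decomposition"
begin

text \<open>Put \<open>A = \<complex>[G]\<close>, \<open>\<eta> = \<eta>\<^sub>H\<close> and \<open>f = e - \<eta>\<close>. Summing coefficients shows that \<open>\<eta>e = \<eta>\<close> also gives
\<open>e\<eta> = \<eta>\<close> (\<open>eta_idempotent_relations\<close>). Therefore \<open>f\<close>, \<open>\<eta>\<close> and \<open>1 - e\<close> are orthogonal idempotents with
sum 1, and the conditions that define the weak lumping algebra \<open>\<Theta>(e)\<close> kill three of the nine
Peirce components of \<open>w\<close>. If the idempotents are listed as \<open>f\<close>, \<open>\<eta>\<close>, \<open>1 - e\<close>, the algebra consists of the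
block lower triangular elements. The asserted decomposition groups the six remaining components: those
in \<open>Af + (1 - e)A\<close> and the middle one, \<open>\<eta>A\<eta>\<close> (\<open>peirce_decomposition\<close>, \<open>peirce_independent\<close>).

The same description gives \<open>\<Theta>(e) = {w. ewe = ew \<and> fwf = fw}\<close> (\<open>weak_lumping_eq_stabilizer\<close>), the
stabilizer, under right multiplication, of the flag \<open>Af \<subseteq> Ae\<close> of left ideals. Such a set is a
subalgebra, and its conjugates are the sets of the same kind for the conjugate idempotents. So
for parabolicity it suffices to find a unit \<open>u\<close> such that all elements with lower triangular blocks
stabilize the flag of \<open>u\<inverse>eu\<close> and \<open>u\<inverse>fu\<close>. Through the Wedderburn isomorphism this becomes a
question about each matrix block separately: given idempotent matrices \<open>E\<close> and \<open>F\<close> with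
\<open>EF = FE = F\<close>, find a base change after which the row spaces of \<open>F\<close> and \<open>E\<close> are spanned by the first
few unit row vectors. It is obtained from one triangularization of \<open>E + F\<close> that lists its
eigenvalues, all in \<open>{0, 1, 2}\<close>, in decreasing order (\<open>nested_idempotents_stabilize_flag\<close>).\<close>

section \<open>Stabilizers of idempotents\<close>

text \<open>For idempotent \<open>e\<close>, the equation \<open>e \<otimes> w \<otimes> e = e \<otimes> w\<close> says \<open>e \<otimes> w \<in> Re\<close>, that is, right multiplication by
\<open>w\<close> maps the left ideal \<open>Re\<close> into itself. This form avoids the complementary idempotent \<open>\<one> \<ominus> e\<close>,
so that it can be tested through a multiplicative map alone.\<close>

definition (in ring) idem_stabilizer :: "'a \<Rightarrow> 'a set" where
  "idem_stabilizer e = {w \<in> carrier R. e \<otimes> w \<otimes> e = e \<otimes> w}"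

lemma (in ring) idem_stabilizer_subring:
  assumes [simp]: "e \<in> carrier R" and idem: "e \<otimes> e = e"
  shows "subring (idem_stabilizer e) R"
proof (rule subringI)
  fix v w assume "v \<in> idem_stabilizer e" "w \<in> idem_stabilizer e"
  then have [simp]: "v \<in> carrier R" "w \<in> carrier R"
    and v: "e \<otimes> v \<otimes> e = e \<otimes> v" and w: "e \<otimes> w \<otimes> e = e \<otimes> w"
    by (auto simp: idem_stabilizer_def)
  show "v \<oplus> w \<in> idem_stabilizer e"
    using v w by (simp add: idem_stabilizer_def l_distr r_distr)
  have "e \<otimes> (v \<otimes> w) \<otimes> e = e \<otimes> v \<otimes> (e \<otimes> w \<otimes> e)"
    using v by (simp add: m_assoc[symmetric])
  also have "\<dots> = e \<otimes> (v \<otimes> w)"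
    using v w by (simp add: m_assoc[symmetric])
  finally show "v \<otimes> w \<in> idem_stabilizer e"
    by (simp add: idem_stabilizer_def)
qed (auto simp: idem_stabilizer_def idem r_minus l_minus)

text \<open>Conjugation is multiplicative and injective, so the defining equation of the stabilizer may be
tested after conjugating back by \<open>inv u\<close>.\<close>

lemma (in ring) conjugate_mem_idem_stabilizer:
  assumes u: "u \<in> Units R" and [simp]: "e \<in> carrier R" "w \<in> carrier R"
  shows "u \<otimes> w \<otimes> inv u \<in> idem_stabilizer e \<longleftrightarrow> w \<in> idem_stabilizer (inv u \<otimes> e \<otimes> u)"
proof -
  have [simp]: "u \<in> carrier R" "inv u \<in> carrier R" using u by auto
  define conj where "conj x = inv u \<otimes> x \<otimes> u" for x
  have conj_carrier [simp]: "conj x \<in> carrier R" if "x \<in> carrier R" for x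
    using that by (simp add: conj_def)
  have uu: "u \<otimes> (inv u \<otimes> x) = x" "inv u \<otimes> (u \<otimes> x) = x" if "x \<in> carrier R" for x
    using that u by (simp_all add: m_assoc[symmetric])
  have conj_mult: "conj (x \<otimes> y) = conj x \<otimes> conj y" if "x \<in> carrier R" "y \<in> carrier R" for x y
    using that by (simp add: conj_def m_assoc uu)
  have conj_inj: "conj x = conj y \<longleftrightarrow> x = y" if "x \<in> carrier R" "y \<in> carrier R" for x y
  proof
    assume "conj x = conj y"
    then have "u \<otimes> conj x \<otimes> inv u = u \<otimes> conj y \<otimes> inv u" by simp
    then show "x = y" using that u by (simp add: conj_def m_assoc uu)
  qed simp
  let ?W = "u \<otimes> w \<otimes> inv u"
  have W: "conj ?W = w" using u by (simp add: conj_def m_assoc uu)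
  have "?W \<in> idem_stabilizer e \<longleftrightarrow> conj (e \<otimes> ?W \<otimes> e) = conj (e \<otimes> ?W)"
    by (simp add: idem_stabilizer_def conj_inj)
  also have "\<dots> \<longleftrightarrow> conj e \<otimes> w \<otimes> conj e = conj e \<otimes> w"
    by (simp add: conj_mult W)
  also have "\<dots> \<longleftrightarrow> w \<in> idem_stabilizer (conj e)"
    by (simp add: idem_stabilizer_def)
  finally show ?thesis by (simp add: conj_def)
qed

lemma (in ring) conjugate_idempotent:
  assumes u: "u \<in> Units R" and [simp]: "e \<in> carrier R" and idem: "e \<otimes> e = e"
  shows "(inv u \<otimes> e \<otimes> u) \<otimes> (inv u \<otimes> e \<otimes> u) = inv u \<otimes> e \<otimes> u"
proof -
  have [simp]: "u \<in> carrier R" "inv u \<in> carrier R" using u by auto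
  have "(inv u \<otimes> e \<otimes> u) \<otimes> (inv u \<otimes> e \<otimes> u) = inv u \<otimes> (e \<otimes> (u \<otimes> inv u) \<otimes> e) \<otimes> u"
    by (simp add: m_assoc)
  then show ?thesis using u by (simp add: idem)
qed

text \<open>In the definition of a parabolic subalgebra, the set on the left is to be written as a conjugate of
a subalgebra containing the standard Borel subalgebra; this candidate for it is again cut out by two
idempotents, hence a subalgebra for the same reason.\<close>

lemma (in ring) conjugate_image_idem_stabilizers:
  assumes u: "u \<in> Units R" and e: "e \<in> carrier R" and f: "f \<in> carrier R"
  shows "idem_stabilizer e \<inter> idem_stabilizer f = (\<lambda>q. u \<otimes> q \<otimes> inv u) `
    (idem_stabilizer (inv u \<otimes> e \<otimes> u) \<inter> idem_stabilizer (inv u \<otimes> f \<otimes> u))" (is "?S = _ ` ?Q")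
proof (intro equalityI subsetI)
  have [simp]: "u \<in> carrier R" "inv u \<in> carrier R" using u by auto
  fix w assume w: "w \<in> ?S"
  then have [simp]: "w \<in> carrier R" by (simp add: idem_stabilizer_def)
  define q where "q = inv u \<otimes> w \<otimes> u"
  have q: "q \<in> carrier R" by (simp add: q_def)
  have "u \<otimes> q \<otimes> inv u = (u \<otimes> inv u) \<otimes> w \<otimes> (u \<otimes> inv u)"
    by (simp add: q_def m_assoc)
  then have wq: "w = u \<otimes> q \<otimes> inv u" using u by simp
  with w have "q \<in> ?Q"
    using conjugate_mem_idem_stabilizer[OF u _ q] e f by simp
  with wq show "w \<in> (\<lambda>q. u \<otimes> q \<otimes> inv u) ` ?Q" by blast
next
  fix w assume "w \<in> (\<lambda>q. u \<otimes> q \<otimes> inv u) ` ?Q"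
  then obtain q where q: "q \<in> ?Q" and w: "w = u \<otimes> q \<otimes> inv u" by blast
  then have "q \<in> carrier R" by (simp add: idem_stabilizer_def)
  with q show "w \<in> ?S" unfolding w
    using conjugate_mem_idem_stabilizer[OF u] e f by simp
qed

section \<open>Peirce decomposition for nested idempotents\<close>

text \<open>The application is \<open>h = \<eta>\<^sub>H\<close>. With \<open>f = e \<ominus> h\<close> and \<open>c = \<one> \<ominus> e\<close>, the relations make
\<open>f\<close>, \<open>h\<close>, \<open>c\<close> orthogonal idempotents with sum \<open>\<one>\<close>, so \<open>R\<close> is the direct sum of the nine Peirce
components \<open>xRy\<close> with \<open>x\<close> and \<open>y\<close> among them.\<close>

locale nested_idempotents = ring +
  fixes e h
  assumes e_carrier [simp]: "e \<in> carrier R" and h_carrier [simp]: "h \<in> carrier R"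
    and ee: "e \<otimes> e = e" and hh: "h \<otimes> h = h" and eh: "e \<otimes> h = h" and he: "h \<otimes> e = h"
begin

abbreviation f where "f \<equiv> e \<ominus> h"
abbreviation c where "c \<equiv> \<one> \<ominus> e"

lemma f_carrier [simp]: "f \<in> carrier R" and c_carrier [simp]: "c \<in> carrier R"
  by simp_all

lemma peirce:
  "e \<otimes> f = f" "f \<otimes> e = f" "f \<otimes> f = f" "f \<otimes> h = \<zero>" "h \<otimes> f = \<zero>"
  "e \<otimes> c = \<zero>" "c \<otimes> e = \<zero>" "f \<otimes> c = \<zero>" "c \<otimes> h = \<zero>" "h \<otimes> c = \<zero>"
proof -
  show ef: "e \<otimes> f = f" and fe: "f \<otimes> e = f" and fh: "f \<otimes> h = \<zero>" and "h \<otimes> f = \<zero>"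
    and ec: "e \<otimes> c = \<zero>" and "c \<otimes> e = \<zero>" and "c \<otimes> h = \<zero>" and "h \<otimes> c = \<zero>"
    by (simp_all add: a_minus_def l_distr r_distr l_minus r_minus ee hh eh he r_neg)
  have "f \<otimes> f = f \<otimes> e \<oplus> \<ominus> (f \<otimes> h)"
    by (simp add: a_minus_def r_distr r_minus)
  then show "f \<otimes> f = f"
    by (simp add: fe fh)
  have "f \<otimes> c = f \<otimes> e \<otimes> c" by (simp add: fe)
  then show "f \<otimes> c = \<zero>" by (simp add: m_assoc ec)
qed

lemma peirce_assoc:
  assumes "w \<in> carrier R"
  shows "e \<otimes> (e \<otimes> w) = e \<otimes> w" "h \<otimes> (h \<otimes> w) = h \<otimes> w" "e \<otimes> (h \<otimes> w) = h \<otimes> w" "h \<otimes> (e \<otimes> w) = h \<otimes> w"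
   "e \<otimes> (f \<otimes> w) = f \<otimes> w" "f \<otimes> (e \<otimes> w) = f \<otimes> w" "f \<otimes> (f \<otimes> w) = f \<otimes> w" "f \<otimes> (h \<otimes> w) = \<zero>" "h \<otimes> (f \<otimes> w) = \<zero>"
   "e \<otimes> (c \<otimes> w) = \<zero>" "c \<otimes> (e \<otimes> w) = \<zero>" "f \<otimes> (c \<otimes> w) = \<zero>" "c \<otimes> (h \<otimes> w) = \<zero>" "h \<otimes> (c \<otimes> w) = \<zero>"
  using assms by (simp_all add: m_assoc[symmetric] peirce ee hh eh he)

lemma e_split: "e = f \<oplus> h" and one_split: "\<one> = e \<oplus> c"
  by (simp_all add: a_minus_def a_assoc l_neg a_lcomm[of e] r_neg)

text \<open>The left side asks that the Peirce components \<open>fwc\<close>, \<open>hwc\<close> and \<open>fwh\<close> vanish. Since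
\<open>e = f + h\<close> and \<open>\<one> - f = h + c\<close>, the same three components make up \<open>ew(\<one> - e)\<close> and
\<open>fw(\<one> - f)\<close>, so the left side is the stabilizer of the flag \<open>Rf \<subseteq> Re\<close> of left ideals.\<close>

lemma weak_lumping_eq_stabilizer:
  "{w \<in> carrier R. e \<otimes> w \<otimes> c = \<zero> \<and> f \<otimes> w \<otimes> h = \<zero>} = idem_stabilizer e \<inter> idem_stabilizer f"
proof -
  have "e \<otimes> w \<otimes> c = \<zero> \<and> f \<otimes> w \<otimes> h = \<zero> \<longleftrightarrow> e \<otimes> w \<otimes> e = e \<otimes> w \<and> f \<otimes> w \<otimes> f = f \<otimes> w"
    if [simp]: "w \<in> carrier R" for w
  proof -
    have "e \<otimes> w = e \<otimes> w \<otimes> (e \<oplus> c)"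
      by (simp flip: one_split)
    then have ew: "e \<otimes> w = e \<otimes> w \<otimes> e \<oplus> e \<otimes> w \<otimes> c"
      by (simp only: r_distr e_carrier c_carrier m_closed that)
    have cancel: "x \<oplus> y = x \<longleftrightarrow> y = \<zero>" if "x \<in> carrier R" "y \<in> carrier R" for x y
      using that add.l_cancel_one by simp
    have e_iff: "e \<otimes> w \<otimes> c = \<zero> \<longleftrightarrow> e \<otimes> w \<otimes> e = e \<otimes> w"
      using cancel[of "e \<otimes> w \<otimes> e" "e \<otimes> w \<otimes> c"] unfolding ew[symmetric] by auto
    have "f \<otimes> w \<otimes> h = \<zero> \<longleftrightarrow> f \<otimes> w \<otimes> f = f \<otimes> w" if ewe: "e \<otimes> w \<otimes> e = e \<otimes> w"
    proof -
      have "f \<otimes> w = f \<otimes> (e \<otimes> w \<otimes> e)"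
        by (simp add: ewe peirce_assoc)
      also have "\<dots> = f \<otimes> w \<otimes> (f \<oplus> h)"
        by (simp add: m_assoc peirce_assoc flip: e_split)
      also have "\<dots> = f \<otimes> w \<otimes> f \<oplus> f \<otimes> w \<otimes> h"
        by (rule r_distr) simp_all
      finally show ?thesis
        using cancel[of "f \<otimes> w \<otimes> f" "f \<otimes> w \<otimes> h"] by auto
    qed
    with e_iff show ?thesis by blast
  qed
  then show ?thesis by (auto simp: idem_stabilizer_def)
qed

text \<open>Of the six components that may be nonzero, \<open>Rf\<close> and \<open>cR\<close> together contain all but \<open>hRh\<close>.\<close>

lemma peirce_decomposition:
  "{w \<in> carrier R. e \<otimes> w \<otimes> c = \<zero> \<and> f \<otimes> w \<otimes> h = \<zero>} =
    ({w \<otimes> f |w. w \<in> carrier R} <+>\<^bsub>R\<^esub> {c \<otimes> w |w. w \<in> carrier R}) <+>\<^bsub>R\<^esub> {h \<otimes> w \<otimes> h |w. w \<in> carrier R}"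
  (is "?T = ?U <+>\<^bsub>R\<^esub> ?W")
proof (intro equalityI subsetI)
  fix w assume "w \<in> ?T"
  then have [simp]: "w \<in> carrier R" and w1: "e \<otimes> w \<otimes> c = \<zero>" and w2: "f \<otimes> w \<otimes> h = \<zero>"
    by auto
  have "w = e \<otimes> w \<oplus> c \<otimes> w"
    by (metis one_split l_distr l_one e_carrier c_carrier \<open>w \<in> carrier R\<close>)
  also have "e \<otimes> w = e \<otimes> w \<otimes> e \<oplus> e \<otimes> w \<otimes> c"
    by (metis one_split r_distr r_one e_carrier c_carrier m_closed \<open>w \<in> carrier R\<close>)
  also have "\<dots> = e \<otimes> w \<otimes> f \<oplus> e \<otimes> w \<otimes> h"
    using w1 by (metis r_zero e_split r_distr f_carrier h_carrier e_carrier m_closed \<open>w \<in> carrier R\<close>)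
  also have "e \<otimes> w \<otimes> h = f \<otimes> w \<otimes> h \<oplus> h \<otimes> w \<otimes> h"
    by (metis e_split l_distr f_carrier h_carrier m_closed \<open>w \<in> carrier R\<close>)
  finally have "w = (e \<otimes> w \<otimes> f \<oplus> c \<otimes> w) \<oplus> h \<otimes> w \<otimes> h"
    by (simp add: w2 a_ac)
  moreover have "e \<otimes> w \<otimes> f \<oplus> c \<otimes> w \<in> ?U"
    using \<open>w \<in> carrier R\<close> e_carrier m_closed unfolding set_add_def' by blast
  moreover have "h \<otimes> w \<otimes> h \<in> ?W" using \<open>w \<in> carrier R\<close> by blast
  ultimately show "w \<in> ?U <+>\<^bsub>R\<^esub> ?W" unfolding set_add_def'[of _ ?U] by blast
next
  fix w assume "w \<in> ?U <+>\<^bsub>R\<^esub> ?W"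
  then obtain x y z where [simp]: "x \<in> carrier R" "y \<in> carrier R" "z \<in> carrier R"
    and w: "w = (x \<otimes> f \<oplus> c \<otimes> y) \<oplus> h \<otimes> z \<otimes> h"
    unfolding set_add_def' by blast
  show "w \<in> ?T" unfolding w
    by (simp add: l_distr r_distr m_assoc peirce peirce_assoc hh)
qed

text \<open>The projection \<open>w \<mapsto> hwh\<close> is the identity on \<open>hRh\<close> and vanishes on \<open>Rf + cR\<close>.\<close>

lemma peirce_independent:
  "({w \<otimes> f |w. w \<in> carrier R} <+>\<^bsub>R\<^esub> {c \<otimes> w |w. w \<in> carrier R}) \<inter> {h \<otimes> w \<otimes> h |w. w \<in> carrier R} = {\<zero>}"
  (is "?U \<inter> ?W = _")
proof (intro equalityI subsetI)
  fix w assume "w \<in> ?U \<inter> ?W"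
  then obtain x y z where [simp]: "x \<in> carrier R" "y \<in> carrier R" "z \<in> carrier R"
    and xy: "w = x \<otimes> f \<oplus> c \<otimes> y" and z: "w = h \<otimes> z \<otimes> h"
    unfolding set_add_def' by blast
  have "w = h \<otimes> w \<otimes> h" by (simp add: z m_assoc peirce_assoc hh)
  also have "\<dots> = \<zero>" by (simp add: xy l_distr r_distr m_assoc peirce peirce_assoc)
  finally show "w \<in> {\<zero>}" by simp
next
  fix w assume "w \<in> {\<zero>}"
  then have "w = \<zero> \<otimes> f \<oplus> c \<otimes> \<zero>" "w = h \<otimes> \<zero> \<otimes> h" by simp_all
  then show "w \<in> ?U \<inter> ?W" unfolding set_add_def' using zero_closed by blast
qed

end

section \<open>Lower triangular idempotent matrices\<close>

lemma mult_mat_entry: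
  assumes "A \<in> carrier_mat n n" "B \<in> carrier_mat n n" "i < n" "j < n"
  shows "(A * B) $$ (i, j) = (\<Sum>k<n. A $$ (i, k) * B $$ (k, j))"
  using assms by (simp add: scalar_prod_def atLeast0LessThan)

lemma lower_triangularD: 
  "lower_triangular M \<Longrightarrow> M \<in> carrier_mat n n \<Longrightarrow> i < j \<Longrightarrow> j < n \<Longrightarrow> M $$ (i, j) = 0"
  unfolding lower_triangular_def by auto

text \<open>The diagonal block of \<open>g\<close> on the indices from \<open>j\<close> to \<open>i\<close> is itself idempotent, because \<open>g\<close> is
triangular. If its diagonal vanishes it is also nilpotent, hence zero.\<close>

lemma lower_triangular_idempotent_zero:
  assumes g: "g \<in> carrier_mat n n" and low: "lower_triangular g" and idem: "g * g = g"
    and "i < n" "j \<le> i" and diag: "\<And>k. j \<le> k \<Longrightarrow> k \<le> i \<Longrightarrow> g $$ (k, k) = 0"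
  shows "g $$ (i, j) = 0"
  using assms(4-6)
proof (induction i rule: less_induct)
  case (less i)
  have "g $$ (i, j) = (g * g) $$ (i, j)" by (simp add: idem)
  also have "\<dots> = (\<Sum>k<n. g $$ (i, k) * g $$ (k, j))"
    using less.prems by (intro mult_mat_entry[OF g g]) auto
  also have "\<dots> = 0"
  proof (intro sum.neutral ballI)
    fix k assume "k \<in> {..<n}"
    then have "k < n" by simp
    consider "k < j" | "j \<le> k" "k < i" | "k = i" | "i < k" by linarith
    then show "g $$ (i, k) * g $$ (k, j) = 0"
    proof cases
      case 1
      then show ?thesis using lower_triangularD[OF low g, of k j] less.prems by simp
    next
      case 2
      then show ?thesis using less.IH[of k] less.prems \<open>k < n\<close> by simp
    next
      case 3
      then show ?thesis using less.prems by simp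
    next
      case 4
      then show ?thesis using lower_triangularD[OF low g, of i k] \<open>k < n\<close> by simp
    qed
  qed
  finally show ?case .
qed

lemma lower_triangular_mult_diag:
  assumes A: "A \<in> carrier_mat n n" "lower_triangular A" and B: "B \<in> carrier_mat n n" "lower_triangular B" and "i < n"
  shows "(A * B) $$ (i, i) = A $$ (i, i) * B $$ (i, i)"
proof -
  have "(A * B) $$ (i, i) = (\<Sum>k<n. A $$ (i, k) * B $$ (k, i))"
    using A B \<open>i < n\<close> by (intro mult_mat_entry) auto
  also have "\<dots> = (\<Sum>k<n. if k = i then A $$ (i, i) * B $$ (i, i) else 0)"
    using lower_triangularD[OF A(2,1), of i] lower_triangularD[OF B(2,1), of _ i] \<open>i < n\<close>
    by (intro sum.cong refl) (metis lessThan_iff linorder_neqE_nat mult_zero_left mult_zero_right)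
  finally show ?thesis using \<open>i < n\<close> by simp
qed

lemma lower_triangular_mult:
  assumes A: "A \<in> carrier_mat n n" "lower_triangular A" and B: "B \<in> carrier_mat n n" "lower_triangular B"
  shows "lower_triangular (A * B)"
  unfolding lower_triangular_def
proof (intro allI impI)
  fix i j assume ij: "i < dim_row (A * B)" "j < dim_col (A * B)" "i < j"
  then have "(A * B) $$ (i, j) = (\<Sum>k<n. A $$ (i, k) * B $$ (k, j))"
    using A B by (intro mult_mat_entry) auto
  also have "\<dots> = 0"
  proof (intro sum.neutral ballI)
    fix k assume "k \<in> {..<n}"
    then show "A $$ (i, k) * B $$ (k, j) = 0"
      using lower_triangularD[OF A(2,1), of i k] lower_triangularD[OF B(2,1), of k j] ij B
      by (cases "i < k") auto
  qed
  finally show "(A * B) $$ (i, j) = 0" .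
qed

text \<open>By the monotonicity of the diagonal, its ones come before its zeros, so \<open>E\<close> has the block form
\<open>(I 0; X 0)\<close>: this follows from \<open>lower_triangular_idempotent_zero\<close>, applied to \<open>E\<close> for the
last columns and to \<open>1 - E\<close> for the first rows. Hence the row space of \<open>E\<close> is spanned by the first
unit row vectors, and it is preserved under right multiplication by lower triangular matrices.\<close>

lemma lower_triangular_idempotent_stabilizer:
  assumes E: "E \<in> carrier_mat n n" and low: "lower_triangular E" and idem: "E * E = E"
    and mono: "\<And>i j. j \<le> i \<Longrightarrow> i < n \<Longrightarrow> E $$ (i, i) \<noteq> 0 \<Longrightarrow> E $$ (j, j) \<noteq> 0"
    and W: "W \<in> carrier_mat n n" "lower_triangular W"
  shows "E * W * E = E * W"
proof -
  have diag: "E $$ (i, i) = 0 \<or> E $$ (i, i) = 1" if "i < n" for i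
    using lower_triangular_mult_diag[OF E low E low that] by (auto simp: idem)
  have col: "E $$ (i, k) = 0" if "k \<le> i" "i < n" "E $$ (k, k) = 0" for i k
    by (rule lower_triangular_idempotent_zero[OF E low idem \<open>i < n\<close> \<open>k \<le> i\<close>])
      (use mono that in \<open>meson le_less_trans\<close>)
  have row: "E $$ (l, j) = (if j = l then 1 else 0)" if "l < n" "j < n" "E $$ (l, l) \<noteq> 0" for l j
  proof (cases "l < j")
    case True
    then show ?thesis using lower_triangularD[OF low E] that by simp
  next
    case False
    let ?g = "1\<^sub>m n - E"
    have g: "?g \<in> carrier_mat n n" by (rule minus_carrier_mat[OF E])
    have "?g * ?g = 1\<^sub>m n * ?g - E * ?g"
      by (rule minus_mult_distrib_mat[OF one_carrier_mat E g])
    also have "E * ?g = E * 1\<^sub>m n - E * E"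
      by (rule mult_minus_distrib_mat[OF E one_carrier_mat E])
    also have "1\<^sub>m n * ?g - \<dots> = ?g"
      using E g by (intro eq_matI) (auto simp: idem left_mult_one_mat[OF g])
    finally have "?g * ?g = ?g" .
    moreover have "lower_triangular ?g"
      using E lower_triangularD[OF low E] by (auto simp: lower_triangular_def)
    moreover have "?g $$ (k, k) = 0" if "k \<le> l" for k
      using diag[of k] mono[OF that] \<open>l < n\<close> \<open>E $$ (l, l) \<noteq> 0\<close> that E by auto
    ultimately have "?g $$ (l, j) = 0"
      using lower_triangular_idempotent_zero[OF g] \<open>l < n\<close> False by simp
    then show ?thesis using E that by (auto split: if_splits)
  qed
  have EW: "(E * W) $$ (i, l) = 0" if "i < n" "l < n" "E $$ (l, l) = 0" for i l
  proof -
    have "(E * W) $$ (i, l) = (\<Sum>k<n. E $$ (i, k) * W $$ (k, l))"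
      using E W that by (intro mult_mat_entry) auto
    also have "\<dots> = 0"
    proof (intro sum.neutral ballI)
      fix k assume "k \<in> {..<n}"
      then have k: "k < n" by simp
      consider "k < l" | "i < k" | "l \<le> k" "k \<le> i" by linarith
      then show "E $$ (i, k) * W $$ (k, l) = 0"
      proof cases
        case 1
        then show ?thesis using lower_triangularD[OF W(2,1)] that by simp
      next
        case 2
        then show ?thesis using lower_triangularD[OF low E] k by simp
      next
        case 3
        then have "E $$ (k, k) = 0" using mono[of l k] that k by auto
        then show ?thesis using col[of k i] 3 that by simp
      qed
    qed
    finally show ?thesis .
  qed
  show ?thesis
  proof (rule eq_matI)
    fix i j assume "i < dim_row (E * W)" "j < dim_col (E * W)"
    then have ij: "i < n" "j < n" using E W by auto
    then have "(E * W * E) $$ (i, j) = (\<Sum>l<n. (E * W) $$ (i, l) * E $$ (l, j))"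
      using E W by (intro mult_mat_entry) auto
    also have "\<dots> = (\<Sum>l<n. if l = j then (E * W) $$ (i, j) else 0)"
    proof (rule sum.cong[OF refl])
      fix l assume "l \<in> {..<n}"
      then have l: "l < n" by simp
      show "(E * W) $$ (i, l) * E $$ (l, j) = (if l = j then (E * W) $$ (i, j) else 0)"
      proof (cases "E $$ (l, l) = 0")
        case True
        with EW[OF ij(1) l] show ?thesis by (auto simp del: index_mult_mat)
      next
        case False
        with row[OF l ij(2)] show ?thesis by (auto simp del: index_mult_mat)
      qed
    qed
    finally show "(E * W * E) $$ (i, j) = (E * W) $$ (i, j)" using ij by (simp del: index_mult_mat)
  qed (use E W in auto)
qed

section \<open>Straightening a pair of nested idempotent matrices\<close>

text \<open>Schur decomposition gives an upper triangular matrix with the eigenvalues in any prescribed order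
on the diagonal; applied to the transpose of \<open>M\<close>, it gives a lower triangular one.\<close>

lemma similar_lower_triangular_sorted:
  fixes M :: "complex mat"
  assumes M: "M \<in> carrier_mat n n"
  obtains P Q D where "P \<in> carrier_mat n n" "Q \<in> carrier_mat n n" "D \<in> carrier_mat n n"
    "P * Q = 1\<^sub>m n" "Q * P = 1\<^sub>m n" "M = P * D * Q" "lower_triangular D"
    "\<And>i j. j \<le> i \<Longrightarrow> i < n \<Longrightarrow> Re (D $$ (i, i)) \<le> Re (D $$ (j, j))"
proof -
  have MT: "transpose_mat M \<in> carrier_mat n n" using M by simp
  obtain as where as: "char_poly (transpose_mat M) = (\<Prod>a\<leftarrow>as. [:- a, 1:])"
    using char_poly_factorized[OF MT] by blast
  define es where "es = sort_key (\<lambda>z. - Re z) as"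
  have "mset es = mset as" by (simp add: es_def)
  then have "mset (map (\<lambda>a. [:- a, 1:]) es) = mset (map (\<lambda>a. [:- a, 1:]) as)" by simp
  then have "(\<Prod>a\<leftarrow>es. [:- a, 1:]) = (\<Prod>a\<leftarrow>as. [:- a, 1:])"
    using prod_mset_prod_list by metis
  with as have es: "char_poly (transpose_mat M) = (\<Prod>a\<leftarrow>es. [:- a, 1:])" by simp
  obtain B P Q where "schur_decomposition (transpose_mat M) es = (B, P, Q)"
    by (cases "schur_decomposition (transpose_mat M) es")
  note schur = schur_decomposition[OF MT es this]
  then have wit: "similar_mat_wit (transpose_mat M) B P Q" and up: "upper_triangular B"
    and diag: "diag_mat B = es" by auto
  note w = similar_mat_witD2[OF MT wit]
  show thesis
  proof
    have "transpose_mat Q * transpose_mat P = transpose_mat (P * Q)"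
      by (rule transpose_mult[symmetric]) (use w in auto)
    then show "transpose_mat Q * transpose_mat P = 1\<^sub>m n" using w by simp
    have "transpose_mat P * transpose_mat Q = transpose_mat (Q * P)"
      by (rule transpose_mult[symmetric]) (use w in auto)
    then show "transpose_mat P * transpose_mat Q = 1\<^sub>m n" using w by simp
    have "M = transpose_mat (P * B * Q)" using w(3) by (metis transpose_transpose)
    also have "\<dots> = transpose_mat Q * transpose_mat (P * B)"
      by (rule transpose_mult) (use w in auto)
    also have "transpose_mat (P * B) = transpose_mat B * transpose_mat P"
      by (rule transpose_mult) (use w in auto)
    also have "transpose_mat Q * \<dots> = transpose_mat Q * transpose_mat B * transpose_mat P"
      by (rule assoc_mult_mat[symmetric, of _ n n _ n _ n]) (use w in auto)
    finally show "M = transpose_mat Q * transpose_mat B * transpose_mat P" .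
    show "lower_triangular (transpose_mat B)"
      using up w by (auto simp: lower_triangular_def upper_triangular_def)
    fix i j assume ij: "j \<le> i" "i < n"
    have len: "length es = n" using diag w by (auto simp: diag_mat_def)
    have nth: "es ! k = B $$ (k, k)" if "k < n" for k
      using that w by (auto simp: diag_mat_def simp flip: diag)
    have "sorted (map (\<lambda>z. - Re z) es)" by (simp add: es_def)
    from sorted_nth_mono[OF this, of j i] show "Re (transpose_mat B $$ (i, i)) \<le> Re (transpose_mat B $$ (j, j))"
      using ij len nth w by simp
  qed (use w in auto)
qed

text \<open>A single triangularization serves both idempotents, because both are polynomials in \<open>D = E + F\<close>:
the relations give \<open>D\<^sup>2 = E + 3F\<close>, so that \<open>2F = D\<^sup>2 - D\<close>. The eigenvalues of \<open>D\<close> lie in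
\<open>{0, 1, 2}\<close>; sorting them in decreasing order puts the ones of \<open>F\<close> and of \<open>E\<close> first on their diagonals.\<close>

lemma nested_idempotents_stabilize_flag:
  fixes E F :: "complex mat"
  assumes E: "E \<in> carrier_mat n n" and F: "F \<in> carrier_mat n n"
    and EE: "E * E = E" and FF: "F * F = F" and EF: "E * F = F" and FE: "F * E = F"
  obtains P Q where "P \<in> carrier_mat n n" "Q \<in> carrier_mat n n" "P * Q = 1\<^sub>m n" "Q * P = 1\<^sub>m n"
    "\<And>W. W \<in> carrier_mat n n \<Longrightarrow> lower_triangular W \<Longrightarrow>
      (Q * E * P) * W * (Q * E * P) = (Q * E * P) * W \<and> (Q * F * P) * W * (Q * F * P) = (Q * F * P) * W"
proof -
  have "E + F \<in> carrier_mat n n" using E F by simp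
  then obtain P Q D where P: "P \<in> carrier_mat n n" and Q: "Q \<in> carrier_mat n n" and D: "D \<in> carrier_mat n n"
    and PQ: "P * Q = 1\<^sub>m n" and QP: "Q * P = 1\<^sub>m n" and EFD: "E + F = P * D * Q"
    and low: "lower_triangular D"
    and sorted: "\<And>i j. j \<le> i \<Longrightarrow> i < n \<Longrightarrow> Re (D $$ (i, i)) \<le> Re (D $$ (j, j))"
    by (rule similar_lower_triangular_sorted) blast
  define conj where "conj X = Q * X * P" for X
  have conj_carrier [simp]: "conj X \<in> carrier_mat n n" if "X \<in> carrier_mat n n" for X
    using P Q that by (simp add: conj_def)
  have PQX: "P * (Q * X) = X" if "X \<in> carrier_mat n n" for X
    using assoc_mult_mat[OF P Q that] that by (simp add: PQ)
  have QPX: "Q * (P * X) = X" if "X \<in> carrier_mat n n" for X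
    using assoc_mult_mat[OF Q P that] that by (simp add: QP)
  have assoc: "X * Y * Z = X * (Y * Z)" 
    if "X \<in> carrier_mat n n" "Y \<in> carrier_mat n n" "Z \<in> carrier_mat n n" for X Y Z :: "complex mat"
    using that by (rule assoc_mult_mat)
  have closed: "X * Y \<in> carrier_mat n n" 
    if "X \<in> carrier_mat n n" "Y \<in> carrier_mat n n" for X Y :: "complex mat"
    using that by (rule mult_carrier_mat)
  have conj_mult: "conj X * conj Y = conj (X * Y)" if "X \<in> carrier_mat n n" "Y \<in> carrier_mat n n" for X Y
    using that P Q by (simp add: conj_def assoc closed PQX del: mult_carrier_mat)
  have conj_add: "conj X + conj Y = conj (X + Y)" if "X \<in> carrier_mat n n" "Y \<in> carrier_mat n n" for X Y
    using that P Q 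
    by (simp add: conj_def mult_add_distrib_mat[of _ n n] add_mult_distrib_mat[of _ n n])
  let ?E = "conj E" and ?F = "conj F"
  have EFD': "?E + ?F = D"
    using P Q D E F by (simp add: conj_add EFD) (simp add: conj_def assoc closed QPX QP)
  have EE': "?E * ?E = ?E" and FF': "?F * ?F = ?F" and EF': "?E * ?F = ?F" and FE': "?F * ?E = ?F"
    using E F by (simp_all add: conj_mult EE FF EF FE)
  have Ec: "?E \<in> carrier_mat n n" and Fc: "?F \<in> carrier_mat n n" using E F by simp_all
  have DD: "D * D = ?E + ?F + ?F + ?F"
  proof -
    have "D * D = (?E + ?F) * ?E + (?E + ?F) * ?F"
      unfolding EFD'[symmetric] using Ec Fc by (intro mult_add_distrib_mat[of _ n n]) auto
    also have "\<dots> = (?E + ?F) + (?F + ?F)"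
      using Ec Fc by (simp add: add_mult_distrib_mat[of _ n n] EE' FF' EF' FE')
    finally show ?thesis using Ec Fc by (simp add: assoc_add_mat[of _ n n])
  qed
  have DDlow: "lower_triangular (D * D)" by (rule lower_triangular_mult[OF D low D low])
  have Dentry: "D $$ (i, j) = ?E $$ (i, j) + ?F $$ (i, j)" if "i < n" "j < n" for i j
    using that Ec Fc by (simp flip: EFD')
  \<comment> \<open>Above the diagonal both \<open>E + F\<close> and \<open>E + 3F\<close> vanish.\<close>
  have "?E $$ (i, j) = 0 \<and> ?F $$ (i, j) = 0" if "i < j" "j < n" for i j
  proof -
    have "D $$ (i, j) = 0" "(D * D) $$ (i, j) = 0"
      using lower_triangularD[OF low D] lower_triangularD[OF DDlow, of n] D that by auto
    then have EF0: "?E $$ (i, j) + ?F $$ (i, j) = 0"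
      using that Dentry[of i j] by simp
    have "(D * D) $$ (i, j) = ?E $$ (i, j) + ?F $$ (i, j) + ?F $$ (i, j) + ?F $$ (i, j)"
      unfolding DD using that Ec Fc by simp
    then have "?F $$ (i, j) + ?F $$ (i, j) = 0"
      using EF0 \<open>(D * D) $$ (i, j) = 0\<close> by simp
    then show ?thesis using EF0 by simp
  qed
  then have Elow: "lower_triangular ?E" and Flow: "lower_triangular ?F"
    using Ec Fc by (auto simp: lower_triangular_def)
  have diag: "(?E $$ (i, i) = 0 \<and> ?F $$ (i, i) = 0 \<and> Re (D $$ (i, i)) = 0) \<or>
     (?E $$ (i, i) = 1 \<and> ?F $$ (i, i) = 0 \<and> Re (D $$ (i, i)) = 1) \<or>
     (?E $$ (i, i) = 1 \<and> ?F $$ (i, i) = 1 \<and> Re (D $$ (i, i)) = 2)" if "i < n" for i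
    using lower_triangular_mult_diag[OF Ec Elow Ec Elow that] 
      lower_triangular_mult_diag[OF Fc Flow Fc Flow that]
      lower_triangular_mult_diag[OF Ec Elow Fc Flow that] Dentry[OF that that]
    by (auto simp: EE' FF' EF')
  have Emono: "?E $$ (j, j) \<noteq> 0" if "j \<le> i" "i < n" "?E $$ (i, i) \<noteq> 0" for i j
    using diag[of i] diag[of j] sorted[of j i] that by auto
  have Fmono: "?F $$ (j, j) \<noteq> 0" if "j \<le> i" "i < n" "?F $$ (i, i) \<noteq> 0" for i j
    using diag[of i] diag[of j] sorted[of j i] that by auto
  show thesis
  proof
    fix W :: "complex mat" assume W: "W \<in> carrier_mat n n" "lower_triangular W"
    show "(Q * E * P) * W * (Q * E * P) = (Q * E * P) * W \<and> (Q * F * P) * W * (Q * F * P) = (Q * F * P) * W"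
      using lower_triangular_idempotent_stabilizer[OF Ec Elow EE' Emono W]
        lower_triangular_idempotent_stabilizer[OF Fc Flow FF' Fmono W] by (simp add: conj_def)
  qed (use P Q PQ QP in auto)
qed

section \<open>Products of matrix algebras\<close>

lemma matrix_blocks_simps:
  "carrier (matrix_blocks I d) = (\<Pi>\<^sub>E i\<in>I. carrier_mat (d i) (d i))"
  "i \<in> I \<Longrightarrow> (M \<otimes>\<^bsub>matrix_blocks I d\<^esub> N) i = M i * N i"
  "i \<in> I \<Longrightarrow> \<one>\<^bsub>matrix_blocks I d\<^esub> i = 1\<^sub>m (d i)"
  by (simp_all add: matrix_blocks_def)

lemma ring_iso_matrix_blocks:
  assumes iso: "\<phi> \<in> ring_iso A (matrix_blocks I d)"
  shows "\<And>w i. w \<in> carrier A \<Longrightarrow> i \<in> I \<Longrightarrow> \<phi> w i \<in> carrier_mat (d i) (d i)"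
    and "\<And>v w i. v \<in> carrier A \<Longrightarrow> w \<in> carrier A \<Longrightarrow> i \<in> I \<Longrightarrow> \<phi> (v \<otimes>\<^bsub>A\<^esub> w) i = \<phi> v i * \<phi> w i"
    and "\<And>i. i \<in> I \<Longrightarrow> \<phi> \<one>\<^bsub>A\<^esub> i = 1\<^sub>m (d i)"
    and "\<And>v w. v \<in> carrier A \<Longrightarrow> w \<in> carrier A \<Longrightarrow> (\<And>i. i \<in> I \<Longrightarrow> \<phi> v i = \<phi> w i) \<Longrightarrow> v = w"
    and "\<And>M. (\<And>i. i \<in> I \<Longrightarrow> M i \<in> carrier_mat (d i) (d i)) \<Longrightarrow> \<exists>w\<in>carrier A. \<forall>i\<in>I. \<phi> w i = M i"
proof -
  have hom: "\<phi> \<in> Ring.ring_hom A (matrix_blocks I d)" and bij: "bij_betw \<phi> (carrier A) (carrier (matrix_blocks I d))"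
    using iso by (auto simp: ring_iso_def)
  have closed: "\<phi> w \<in> (\<Pi>\<^sub>E i\<in>I. carrier_mat (d i) (d i))" if "w \<in> carrier A" for w
    using ring_hom_closed[OF hom that] by (simp add: matrix_blocks_simps)
  then show "\<phi> w i \<in> carrier_mat (d i) (d i)" if "w \<in> carrier A" "i \<in> I" for w i
    using that by blast
  show "\<phi> (v \<otimes>\<^bsub>A\<^esub> w) i = \<phi> v i * \<phi> w i" if "v \<in> carrier A" "w \<in> carrier A" "i \<in> I" for v w i
    using ring_hom_mult[OF hom that(1,2)] that(3) by (simp add: matrix_blocks_simps)
  show "\<phi> \<one>\<^bsub>A\<^esub> i = 1\<^sub>m (d i)" if "i \<in> I" for i
    using ring_hom_one[OF hom] that by (simp add: matrix_blocks_simps)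
  show "v = w" if "v \<in> carrier A" "w \<in> carrier A" "\<And>i. i \<in> I \<Longrightarrow> \<phi> v i = \<phi> w i" for v w
  proof -
    have "\<phi> v = \<phi> w" using closed[OF that(1)] closed[OF that(2)] that(3) by (rule PiE_ext)
    then show ?thesis using bij that by (auto simp: bij_betw_def inj_on_def)
  qed
  show "\<exists>w\<in>carrier A. \<forall>i\<in>I. \<phi> w i = M i" if "\<And>i. i \<in> I \<Longrightarrow> M i \<in> carrier_mat (d i) (d i)" for M
  proof -
    have "restrict M I \<in> carrier (matrix_blocks I d)" using that by (simp add: matrix_blocks_simps)
    then have "restrict M I \<in> \<phi> ` carrier A" using bij by (simp add: bij_betw_def)
    then obtain w where "w \<in> carrier A" "\<phi> w = restrict M I" by force
    then show ?thesis by (intro bexI[of _ w]) auto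
  qed
qed

text \<open>The base changes that straighten the flags of all blocks are independent of each other, so they
combine to one unit of \<open>R\<close>.\<close>

lemma (in ring) matrix_blocks_borel_stabilizes:
  fixes d :: "'i \<Rightarrow> nat" and \<phi> :: "'a \<Rightarrow> 'i \<Rightarrow> complex mat"
  assumes iso: "\<phi> \<in> ring_iso R (matrix_blocks I d)"
    and e [simp]: "e \<in> carrier R" and f [simp]: "f \<in> carrier R"
    and ee: "e \<otimes> e = e" and ff: "f \<otimes> f = f" and ef: "e \<otimes> f = f" and fe: "f \<otimes> e = f"
  obtains u where "u \<in> Units R" 
    "{w \<in> carrier R. \<forall>i\<in>I. lower_triangular (\<phi> w i)} \<subseteq>
      idem_stabilizer (inv u \<otimes> e \<otimes> u) \<inter> idem_stabilizer (inv u \<otimes> f \<otimes> u)"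
proof -
  note [simp] = ring_iso_matrix_blocks(1,2,3)[OF iso]
  note eqI = ring_iso_matrix_blocks(4)[OF iso] and ex = ring_iso_matrix_blocks(5)[OF iso]
  define straightens where "straightens i P Q \<longleftrightarrow>
    P \<in> carrier_mat (d i) (d i) \<and> Q \<in> carrier_mat (d i) (d i) \<and> P * Q = 1\<^sub>m (d i) \<and> Q * P = 1\<^sub>m (d i) \<and>
    (\<forall>W\<in>carrier_mat (d i) (d i). lower_triangular W \<longrightarrow>
      (Q * \<phi> e i * P) * W * (Q * \<phi> e i * P) = (Q * \<phi> e i * P) * W \<and>
      (Q * \<phi> f i * P) * W * (Q * \<phi> f i * P) = (Q * \<phi> f i * P) * W)" for i P Q
  have "\<exists>P Q. straightens i P Q" if i: "i \<in> I" for i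
  proof (rule nested_idempotents_stabilize_flag[of "\<phi> e i" "d i" "\<phi> f i"])
    show "\<phi> e i * \<phi> e i = \<phi> e i" "\<phi> f i * \<phi> f i = \<phi> f i" "\<phi> e i * \<phi> f i = \<phi> f i" "\<phi> f i * \<phi> e i = \<phi> f i"
      using i by (simp_all add: ee ff ef fe flip: ring_iso_matrix_blocks(2)[OF iso])
  qed (use i straightens_def in auto)
  then obtain P Q where PQ_straightens: "\<And>i. i \<in> I \<Longrightarrow> straightens i (P i) (Q i)"
    by metis
  then have P: "\<And>i. i \<in> I \<Longrightarrow> P i \<in> carrier_mat (d i) (d i)" and Q: "\<And>i. i \<in> I \<Longrightarrow> Q i \<in> carrier_mat (d i) (d i)"
    and PQ: "\<And>i. i \<in> I \<Longrightarrow> P i * Q i = 1\<^sub>m (d i)" and QP: "\<And>i. i \<in> I \<Longrightarrow> Q i * P i = 1\<^sub>m (d i)"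
    by (simp_all add: straightens_def)
  obtain u u' where u [simp]: "u \<in> carrier R" and u' [simp]: "u' \<in> carrier R"
    and \<phi>u: "\<And>i. i \<in> I \<Longrightarrow> \<phi> u i = P i" and \<phi>u': "\<And>i. i \<in> I \<Longrightarrow> \<phi> u' i = Q i"
    using ex[of P, OF P] ex[of Q, OF Q] by blast
  have uu': "u \<otimes> u' = \<one>" and u'u: "u' \<otimes> u = \<one>"
    by (rule eqI; simp add: \<phi>u \<phi>u' PQ QP)+
  then have unit: "u \<in> Units R" using u u' by (auto simp: Units_def)
  have inv: "inv u = u'" using inv_char[OF u u' uu' u'u] .
  show thesis
  proof
    show "u \<in> Units R" by (rule unit)
    show "{w \<in> carrier R. \<forall>i\<in>I. lower_triangular (\<phi> w i)} \<subseteq>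
      idem_stabilizer (inv u \<otimes> e \<otimes> u) \<inter> idem_stabilizer (inv u \<otimes> f \<otimes> u)"
    proof
      fix w assume "w \<in> {w \<in> carrier R. \<forall>i\<in>I. lower_triangular (\<phi> w i)}"
      then have [simp]: "w \<in> carrier R" and low: "\<And>i. i \<in> I \<Longrightarrow> lower_triangular (\<phi> w i)" by auto
      have "(u' \<otimes> e \<otimes> u) \<otimes> w \<otimes> (u' \<otimes> e \<otimes> u) = (u' \<otimes> e \<otimes> u) \<otimes> w"
        by (rule eqI) (use PQ_straightens low in \<open>simp_all add: straightens_def \<phi>u \<phi>u'\<close>)
      moreover have "(u' \<otimes> f \<otimes> u) \<otimes> w \<otimes> (u' \<otimes> f \<otimes> u) = (u' \<otimes> f \<otimes> u) \<otimes> w"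
        by (rule eqI) (use PQ_straightens low in \<open>simp_all add: straightens_def \<phi>u \<phi>u'\<close>)
      ultimately show "w \<in> idem_stabilizer (inv u \<otimes> e \<otimes> u) \<inter> idem_stabilizer (inv u \<otimes> f \<otimes> u)"
        by (simp add: idem_stabilizer_def inv)
    qed
  qed
qed

section \<open>The complex group algebra of a finite group\<close>

locale finite_group_algebra = group G for G :: "('a, 'b) monoid_scheme" (structure) +
  assumes fin: "finite (carrier G)"
begin

abbreviation CG where "CG \<equiv> group_algebra G"

lemma CG_simps:
  "carrier CG = {w. \<forall>x. x \<notin> carrier G \<longrightarrow> w x = 0}"
  "v \<otimes>\<^bsub>CG\<^esub> w = (\<lambda>x. if x \<in> carrier G then \<Sum>y\<in>carrier G. v y * w (inv y \<otimes> x) else 0)"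
  "\<one>\<^bsub>CG\<^esub> = (\<lambda>x. if x = \<one> then 1 else 0)"
  "\<zero>\<^bsub>CG\<^esub> = (\<lambda>x. 0)"
  "v \<oplus>\<^bsub>CG\<^esub> w = (\<lambda>x. v x + w x)"
  "c \<odot>\<^bsub>CG\<^esub> w = (\<lambda>x. c * w x)"
  by (simp_all add: group_algebra_def)

text \<open>Both sides sum \<open>u z * v t * w s\<close> over the factorizations \<open>z \<otimes> t \<otimes> s = x\<close>.\<close>

lemma convolution_assoc:
  "(u \<otimes>\<^bsub>CG\<^esub> v) \<otimes>\<^bsub>CG\<^esub> w = u \<otimes>\<^bsub>CG\<^esub> (v \<otimes>\<^bsub>CG\<^esub> w)"
proof (rule ext)
  fix x
  show "((u \<otimes>\<^bsub>CG\<^esub> v) \<otimes>\<^bsub>CG\<^esub> w) x = (u \<otimes>\<^bsub>CG\<^esub> (v \<otimes>\<^bsub>CG\<^esub> w)) x"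
  proof (cases "x \<in> carrier G")
    case x: True
    have "((u \<otimes>\<^bsub>CG\<^esub> v) \<otimes>\<^bsub>CG\<^esub> w) x =
        (\<Sum>y\<in>carrier G. \<Sum>z\<in>carrier G. u z * (v (inv z \<otimes> y) * w (inv y \<otimes> x)))"
      using x by (simp add: CG_simps sum_distrib_right mult.assoc)
    also have "\<dots> = (\<Sum>z\<in>carrier G. \<Sum>y\<in>carrier G. u z * (v (inv z \<otimes> y) * w (inv y \<otimes> x)))"
      by (rule sum.swap)
    also have "\<dots> = (\<Sum>z\<in>carrier G. \<Sum>t\<in>carrier G. u z * (v t * w (inv t \<otimes> (inv z \<otimes> x))))"
    proof (rule sum.cong[OF refl])
      fix z assume z: "z \<in> carrier G"
      have cancel: "z \<otimes> (inv z \<otimes> y) = y" "inv z \<otimes> (z \<otimes> y) = y" if "y \<in> carrier G" for y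
        using z that by (simp_all flip: m_assoc)
      show "(\<Sum>y\<in>carrier G. u z * (v (inv z \<otimes> y) * w (inv y \<otimes> x))) =
          (\<Sum>t\<in>carrier G. u z * (v t * w (inv t \<otimes> (inv z \<otimes> x))))"
        by (rule sum.reindex_bij_witness[where i = "\<lambda>t. z \<otimes> t" and j = "\<lambda>y. inv z \<otimes> y"])
          (use x z in \<open>auto simp: inv_mult_group m_assoc cancel\<close>)
    qed
    also have "\<dots> = (u \<otimes>\<^bsub>CG\<^esub> (v \<otimes>\<^bsub>CG\<^esub> w)) x"
      using x by (simp add: CG_simps sum_distrib_left)
    finally show ?thesis .
  qed (simp add: CG_simps)
qed

lemma ring_CG: "ring CG"
proof (rule ringI)
  show "abelian_group CG"
  proof (rule abelian_groupI)
    fix v assume "v \<in> carrier CG"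
    then show "\<exists>w\<in>carrier CG. w \<oplus>\<^bsub>CG\<^esub> v = \<zero>\<^bsub>CG\<^esub>"
      by (intro bexI[of _ "\<lambda>x. - v x"]) (auto simp: CG_simps)
  qed (auto simp: CG_simps)
  show "monoid CG"
  proof (rule monoidI)
    fix w assume w: "w \<in> carrier CG"
    show "\<one>\<^bsub>CG\<^esub> \<otimes>\<^bsub>CG\<^esub> w = w"
    proof (rule ext)
      fix x
      have "(\<Sum>y\<in>carrier G. (if y = \<one> then 1 else 0) * w (inv y \<otimes> x)) =
          (\<Sum>y\<in>carrier G. if y = \<one> then w x else 0)" if "x \<in> carrier G"
        using that by (intro sum.cong) auto
      then show "(\<one>\<^bsub>CG\<^esub> \<otimes>\<^bsub>CG\<^esub> w) x = w x"
        using w fin by (auto simp: CG_simps)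
    qed
    show "w \<otimes>\<^bsub>CG\<^esub> \<one>\<^bsub>CG\<^esub> = w"
    proof (rule ext)
      fix x
      have "inv y \<otimes> x = \<one> \<longleftrightarrow> y = x" if "x \<in> carrier G" "y \<in> carrier G" for y
        using that inv_solve_left[of \<one> y x] by auto
      then have "(\<Sum>y\<in>carrier G. w y * (if inv y \<otimes> x = \<one> then 1 else 0)) =
          (\<Sum>y\<in>carrier G. if y = x then w x else 0)" if "x \<in> carrier G"
        using that by (intro sum.cong) auto
      then show "(w \<otimes>\<^bsub>CG\<^esub> \<one>\<^bsub>CG\<^esub>) x = w x"
        using w fin by (auto simp: CG_simps)
    qed
  qed (rule convolution_assoc | force simp: CG_simps)+
qed (auto simp: CG_simps algebra_simps sum.distrib)

sublocale CG: ring CG by (rule ring_CG)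

lemma smult_mult:
  "(c \<odot>\<^bsub>CG\<^esub> v) \<otimes>\<^bsub>CG\<^esub> w = c \<odot>\<^bsub>CG\<^esub> (v \<otimes>\<^bsub>CG\<^esub> w)" "v \<otimes>\<^bsub>CG\<^esub> (c \<odot>\<^bsub>CG\<^esub> w) = c \<odot>\<^bsub>CG\<^esub> (v \<otimes>\<^bsub>CG\<^esub> w)"
  by (auto simp: CG_simps sum_distrib_left mult_ac)

lemma smult_closed: "w \<in> carrier CG \<Longrightarrow> c \<odot>\<^bsub>CG\<^esub> w \<in> carrier CG"
  by (simp add: CG_simps)

lemma vectorspace_CG: "vectorspace class_ring CG"
proof (rule vectorspace.intro)
  show "module class_ring CG"
    by (rule moduleI) (auto simp: class_cring.cring_axioms CG.abelian_group_axioms CG_simps algebra_simps)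
qed (rule class_field)

lemma subspace_CG_I:
  assumes "U \<subseteq> carrier CG" "\<zero>\<^bsub>CG\<^esub> \<in> U"
    and "\<And>v w. v \<in> U \<Longrightarrow> w \<in> U \<Longrightarrow> v \<oplus>\<^bsub>CG\<^esub> w \<in> U"
    and "\<And>c w. w \<in> U \<Longrightarrow> c \<odot>\<^bsub>CG\<^esub> w \<in> U"
  shows "subspace class_ring U CG"
  using assms vectorspace_CG
  by (intro subspace.intro submodule.intro) (auto simp: vectorspace_def)

lemma subspace_CG_sum:
  assumes "subspace class_ring U CG" "subspace class_ring W CG"
  shows "subspace class_ring (U <+>\<^bsub>CG\<^esub> W) CG"
proof -
  interpret vectorspace class_ring CG by (rule vectorspace_CG)
  have "U <+>\<^bsub>CG\<^esub> W = subspace_sum U W"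
    by (auto simp: submodule_sum_def set_add_def')
  then show ?thesis using sum_is_subspace[OF assms] by simp
qed

lemma subspace_CG_image:
  assumes closed: "\<And>w. w \<in> carrier CG \<Longrightarrow> T w \<in> carrier CG" 
    and add: "\<And>v w. v \<in> carrier CG \<Longrightarrow> w \<in> carrier CG \<Longrightarrow> T (v \<oplus>\<^bsub>CG\<^esub> w) = T v \<oplus>\<^bsub>CG\<^esub> T w"
    and smult: "\<And>c w. w \<in> carrier CG \<Longrightarrow> T (c \<odot>\<^bsub>CG\<^esub> w) = c \<odot>\<^bsub>CG\<^esub> T w"
  shows "subspace class_ring {T w |w. w \<in> carrier CG} CG"
proof (rule subspace_CG_I)
  show "{T w |w. w \<in> carrier CG} \<subseteq> carrier CG" using closed by blast
  have "T (0 \<odot>\<^bsub>CG\<^esub> \<zero>\<^bsub>CG\<^esub>) = 0 \<odot>\<^bsub>CG\<^esub> T \<zero>\<^bsub>CG\<^esub>" by (rule smult) simp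
  then have "\<zero>\<^bsub>CG\<^esub> = T \<zero>\<^bsub>CG\<^esub>" by (simp add: CG_simps)
  then show "\<zero>\<^bsub>CG\<^esub> \<in> {T w |w. w \<in> carrier CG}" by blast
  fix v w assume "v \<in> {T w |w. w \<in> carrier CG}" "w \<in> {T w |w. w \<in> carrier CG}"
  then obtain v' w' where "v = T v'" "w = T w'" "v' \<in> carrier CG" "w' \<in> carrier CG" by blast
  then have "v \<oplus>\<^bsub>CG\<^esub> w = T (v' \<oplus>\<^bsub>CG\<^esub> w')" "v' \<oplus>\<^bsub>CG\<^esub> w' \<in> carrier CG" by (simp_all add: add)
  then show "v \<oplus>\<^bsub>CG\<^esub> w \<in> {T w |w. w \<in> carrier CG}" by blast
next
  fix c w assume "w \<in> {T w |w. w \<in> carrier CG}"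
  then obtain w' where "w = T w'" "w' \<in> carrier CG" by blast
  then have "c \<odot>\<^bsub>CG\<^esub> w = T (c \<odot>\<^bsub>CG\<^esub> w')" "c \<odot>\<^bsub>CG\<^esub> w' \<in> carrier CG"
    by (simp_all add: smult smult_closed)
  then show "c \<odot>\<^bsub>CG\<^esub> w \<in> {T w |w. w \<in> carrier CG}" by blast
qed

text \<open>An element \<open>v\<close> supported on \<open>H\<close> multiplies \<open>eta H\<close>, from either side, by the sum of its
coefficients. Hence for \<open>e\<close> in the group algebra of \<open>H\<close> the equation \<open>\<eta>\<^sub>H e = \<eta>\<^sub>H\<close> says that the
coefficients of \<open>e\<close> sum to 1, and implies \<open>e \<eta>\<^sub>H = \<eta>\<^sub>H\<close>.\<close>

lemma eta_idempotent_relations: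
  assumes H: "subgroup H G" and e: "e \<in> E_bullet G H"
  shows "e \<in> carrier CG" "eta H \<in> carrier CG" "e \<otimes>\<^bsub>CG\<^esub> e = e" "eta H \<otimes>\<^bsub>CG\<^esub> e = eta H"
    "e \<otimes>\<^bsub>CG\<^esub> eta H = eta H" "eta H \<otimes>\<^bsub>CG\<^esub> eta H = eta H"
proof -
  have HG: "H \<subseteq> carrier G" and one: "\<one> \<in> H" using H by (auto simp: subgroup_def)
  have finH: "finite H" using HG fin finite_subset by blast
  have cardH: "(of_nat (card H) :: complex) \<noteq> 0" using finH one by auto
  have e0: "e x = 0" if "x \<notin> H" for x
    using e that by (simp add: E_bullet_def group_algebra_def)
  show "e \<in> carrier CG" using e0 HG by (auto simp: CG_simps)
  show "eta H \<in> carrier CG" using HG by (auto simp: CG_simps eta_def)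
  show "e \<otimes>\<^bsub>CG\<^esub> e = e" and eta_e: "eta H \<otimes>\<^bsub>CG\<^esub> e = eta H"
    using e by (simp_all add: E_bullet_def)
  have absorb: "v \<otimes>\<^bsub>CG\<^esub> eta H = (\<lambda>x. (\<Sum>y\<in>H. v y) * eta H x)" if v: "\<And>x. x \<notin> H \<Longrightarrow> v x = 0" for v
  proof (rule ext)
    fix x
    have "(\<Sum>y\<in>carrier G. v y * eta H (inv y \<otimes> x)) = (\<Sum>y\<in>H. v y * eta H x)" if x: "x \<in> carrier G"
    proof (rule sum.mono_neutral_cong_right)
      fix y assume y: "y \<in> H"
      have "inv y \<otimes> x \<in> H \<longleftrightarrow> x \<in> H"
      proof
        assume "inv y \<otimes> x \<in> H"
        then have "y \<otimes> (inv y \<otimes> x) \<in> H" using y H by (simp add: subgroup.m_closed)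
        moreover have "y \<otimes> (inv y \<otimes> x) = x" using x y HG by (simp add: m_assoc[symmetric] subsetD)
        ultimately show "x \<in> H" by simp
      next
        assume "x \<in> H"
        then show "inv y \<otimes> x \<in> H" using y H by (simp add: subgroup.m_closed subgroup.m_inv_closed)
      qed
      then show "v y * eta H (inv y \<otimes> x) = v y * eta H x" by (simp add: eta_def)
    qed (use fin HG v in auto)
    then show "(v \<otimes>\<^bsub>CG\<^esub> eta H) x = (\<Sum>y\<in>H. v y) * eta H x"
      using HG by (auto simp: CG_simps sum_distrib_right eta_def)
  qed
  \<comment> \<open>Compare the coefficients of the neutral element in \<open>\<eta>\<^sub>H e = \<eta>\<^sub>H\<close>.\<close>
  have "(\<Sum>y\<in>H. e y) = 1"
  proof -
    have "eta H \<one> = (\<Sum>y\<in>carrier G. eta H y * e (inv y \<otimes> \<one>))"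
      by (subst eta_e[symmetric]) (simp add: CG_simps)
    also have "\<dots> = (\<Sum>y\<in>H. e (inv y) / of_nat (card H))"
      by (rule sum.mono_neutral_cong_right) (use fin HG in \<open>auto simp: eta_def\<close>)
    also have "\<dots> = (\<Sum>y\<in>H. e y / of_nat (card H))"
      by (rule sum.reindex_bij_witness[where i = "\<lambda>y. inv y" and j = "\<lambda>y. inv y"])
        (use H HG in \<open>auto simp: subgroup.m_inv_closed subsetD\<close>)
    finally show ?thesis using cardH one by (simp add: eta_def flip: sum_divide_distrib)
  qed
  then show "e \<otimes>\<^bsub>CG\<^esub> eta H = eta H" using absorb[of e] e0 by simp
  have "(\<Sum>y\<in>H. eta H y) = 1" using cardH by (simp add: eta_def)
  then show "eta H \<otimes>\<^bsub>CG\<^esub> eta H = eta H" using absorb[of "eta H"] by (simp add: eta_def)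
qed

end

context finite_group_algebra
begin

lemma idem_stabilizers_subalgebra:
  assumes "e \<in> carrier CG" "e \<otimes>\<^bsub>CG\<^esub> e = e" "f \<in> carrier CG" "f \<otimes>\<^bsub>CG\<^esub> f = f"
  shows "is_subalgebra (CG.idem_stabilizer e \<inter> CG.idem_stabilizer f) CG"
  unfolding is_subalgebra_def
proof
  show sub: "subring (CG.idem_stabilizer e \<inter> CG.idem_stabilizer f) CG"
    by (intro CG.subring_inter CG.idem_stabilizer_subring assms)
  show "subspace class_ring (CG.idem_stabilizer e \<inter> CG.idem_stabilizer f) CG"
  proof (rule subspace_CG_I)
    show "c \<odot>\<^bsub>CG\<^esub> w \<in> CG.idem_stabilizer e \<inter> CG.idem_stabilizer f"
      if "w \<in> CG.idem_stabilizer e \<inter> CG.idem_stabilizer f" for c w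
      using that by (simp add: CG.idem_stabilizer_def smult_mult smult_closed)
  qed (use subringE(1,2,7)[OF sub] in \<open>blast+\<close>)
qed

end

section \<open>The weak lumping algebra\<close>

theorem lemma7p1:
  fixes A :: "(complex, 'a \<Rightarrow> complex) module" (structure)
    and G :: "('a, 'b) monoid_scheme"
    and H :: "'a set"
    and e :: "'a \<Rightarrow> complex"
    and \<phi> :: "('a \<Rightarrow> complex) \<Rightarrow> 'a matrix_rep set \<Rightarrow> complex mat"
  assumes "group G" and "finite (carrier G)"
    and "subgroup H G"
    and "wedderburn_iso G \<phi>"
    and "e \<in> E_bullet G H"
    and "A = group_algebra G"
  shows "parabolic G \<phi> (weak_lumping_algebra G H e) \<and>
    internal_direct_sum A (weak_lumping_algebra G H e)
      ({w \<otimes> (e \<ominus> eta H) |w. w \<in> carrier A} <+>\<^bsub>A\<^esub> {(\<one> \<ominus> e) \<otimes> w |w. w \<in> carrier A})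
      {eta H \<otimes> w \<otimes> eta H |w. w \<in> carrier A}"
proof -
  interpret finite_group_algebra G
    using assms by (simp add: finite_group_algebra_def finite_group_algebra_axioms_def)
  note [simp] = \<open>A = group_algebra G\<close>
  note rel = eta_idempotent_relations[OF \<open>subgroup H G\<close> \<open>e \<in> E_bullet G H\<close>]
  interpret nested_idempotents CG e "eta H"
    by unfold_locales (use rel in auto)
  have \<Theta>: "weak_lumping_algebra G H e =
      {w \<in> carrier CG. e \<otimes>\<^bsub>CG\<^esub> w \<otimes>\<^bsub>CG\<^esub> c = \<zero>\<^bsub>CG\<^esub> \<and> f \<otimes>\<^bsub>CG\<^esub> w \<otimes>\<^bsub>CG\<^esub> eta H = \<zero>\<^bsub>CG\<^esub>}"
    by (simp add: weak_lumping_algebra_def Let_def)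
  have iso: "\<phi> \<in> ring_iso CG (matrix_blocks (Irr G) irr_dim)"
    using \<open>wedderburn_iso G \<phi>\<close> by (simp add: wedderburn_iso_def)
  obtain u where u: "u \<in> Units CG" and borel: "standard_borel G \<phi> \<subseteq>
      CG.idem_stabilizer (inv\<^bsub>CG\<^esub> u \<otimes>\<^bsub>CG\<^esub> e \<otimes>\<^bsub>CG\<^esub> u) \<inter> CG.idem_stabilizer (inv\<^bsub>CG\<^esub> u \<otimes>\<^bsub>CG\<^esub> f \<otimes>\<^bsub>CG\<^esub> u)"
    unfolding standard_borel_def
    by (rule CG.matrix_blocks_borel_stabilizes[OF iso e_carrier f_carrier ee peirce(3,1,2)])
  have [simp]: "u \<in> carrier CG" "inv\<^bsub>CG\<^esub> u \<in> carrier CG" using u by auto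
  let ?Q = "CG.idem_stabilizer (inv\<^bsub>CG\<^esub> u \<otimes>\<^bsub>CG\<^esub> e \<otimes>\<^bsub>CG\<^esub> u) \<inter> CG.idem_stabilizer (inv\<^bsub>CG\<^esub> u \<otimes>\<^bsub>CG\<^esub> f \<otimes>\<^bsub>CG\<^esub> u)"
  have "parabolic G \<phi> (weak_lumping_algebra G H e)"
    unfolding parabolic_def Let_def \<Theta> weak_lumping_eq_stabilizer
  proof (intro conjI exI bexI)
    show "is_subalgebra (CG.idem_stabilizer e \<inter> CG.idem_stabilizer f) CG"
      by (rule idem_stabilizers_subalgebra) (simp_all add: ee peirce)
    show "is_subalgebra ?Q CG"
      by (rule idem_stabilizers_subalgebra) (simp_all add: CG.conjugate_idempotent[OF u] ee peirce)
    show "CG.idem_stabilizer e \<inter> CG.idem_stabilizer f = (\<lambda>q. u \<otimes>\<^bsub>CG\<^esub> q \<otimes>\<^bsub>CG\<^esub> inv\<^bsub>CG\<^esub> u) ` ?Q"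
      by (rule CG.conjugate_image_idem_stabilizers[OF u]) simp_all
  qed (fact borel u)+
  moreover have "internal_direct_sum CG (weak_lumping_algebra G H e)
      ({w \<otimes>\<^bsub>CG\<^esub> f |w. w \<in> carrier CG} <+>\<^bsub>CG\<^esub> {c \<otimes>\<^bsub>CG\<^esub> w |w. w \<in> carrier CG})
      {eta H \<otimes>\<^bsub>CG\<^esub> w \<otimes>\<^bsub>CG\<^esub> eta H |w. w \<in> carrier CG}"
    unfolding internal_direct_sum_def \<Theta>
  proof (intro conjI subspace_CG_sum subspace_CG_image)
  qed (rule peirce_decomposition peirce_independent
      | simp add: CG.l_distr CG.r_distr smult_mult smult_closed)+
  ultimately show ?thesis by simp
qed

end
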